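(* $\displaystyle\sum_{n\ge0}|\mathrm{VHC}(\operatorname{Av}_n(132,321))|x^n=\frac{1-3x+3x^2}{(1-x)^4}.$
   Context: $S_n$ is the set of permutations of $[n]$ ($S_0$ contains only the empty permutation); $\operatorname{Av}_n(132,321)$ is the set of $\pi\in S_n$ having no subsequence in the same relative order as $132$ or as $321$. Valid hook configurations. For $\pi=\pi_1\cdots\pi_n$, a descent is $i\in[n-1]$ with $\pi_i>\pi_{i+1}$, and $(i,\pi_i)$ is a descent top of the plot $\{(i,\pi_i)\}$. A hook is determined by $i<j$ with $\pi_i<\pi_j$: vertical segment from $(i,\pi_i)$ up to $(i,\pi_j)$, then horizontal segment to $(j,\pi_j)$; southwest endpoint $(i,\pi_i)$, northeast endpoint $(j,\pi_j)$. If $\pi$ has descents $d_1<\cdots<d_k$, a valid hook configuration is a tuple $(H_1,\dots,H_k)$ of hooks such that (1) $H_i$ has southwest endpoint $(d_i,\pi_{d_i})$; (2) no point of the plot lies directly above a hook; (3) hooks do not intersect or overlap except that the northeast endpoint of one may be the southwest endpoint of another. $\mathrm{VHC}(\pi)$ is the set of these (configurations of distinct permutations are distinct; an increasing permutation, including the empty one, has exactly one, with no hooks); $\mathrm{VHC}(A)=\bigcup_{\pi\in A}\mathrm{VHC}(\pi)$. *)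

theory Defs
  imports
    Complex_Main
    "HOL-Combinatorics.Permutations"
    "HOL-Computational_Algebra.Formal_Power_Series"
begin

text \<open>
  A permutation in $S_n$ is a function \<open>p :: nat \<Rightarrow> nat\<close> with \<open>p permutes {1..n}\<close>. Such a function
  also permutes every larger initial segment, so it does not determine \<open>n\<close>, and \<open>n\<close> is always
  passed as an argument.
\<close>

text \<open>A pattern is given by its one-line notation, e.g. \<open>[1,3,2]\<close> for 132.\<close>

definition contains_pattern :: "nat \<Rightarrow> (nat \<Rightarrow> nat) \<Rightarrow> nat list \<Rightarrow> bool" where
  "contains_pattern n p \<tau> \<longleftrightarrow>
     (\<exists>f. strict_mono_on {..<length \<tau>} f \<and> f ` {..<length \<tau>} \<subseteq> {1..n} \<and>
        (\<forall>a<length \<tau>. \<forall>b<length \<tau>. p (f a) < p (f b) \<longleftrightarrow> \<tau> ! a < \<tau> ! b))"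

definition Av :: "nat \<Rightarrow> nat list set \<Rightarrow> (nat \<Rightarrow> nat) set" where
  "Av n T = {p. p permutes {1..n} \<and> (\<forall>\<tau>\<in>T. \<not> contains_pattern n p \<tau>)}"

definition descents :: "nat \<Rightarrow> (nat \<Rightarrow> nat) \<Rightarrow> nat set" where
  "descents n p = {i. 1 \<le> i \<and> i < n \<and> p i > p (Suc i)}"

definition pt :: "(nat \<Rightarrow> nat) \<Rightarrow> nat \<Rightarrow> real \<times> real" where
  "pt p i = (real i, real (p i))"

definition plot :: "nat \<Rightarrow> (nat \<Rightarrow> nat) \<Rightarrow> (real \<times> real) set" where
  "plot n p = pt p ` {1..n}"

text \<open>
  A hook is encoded by the pair \<open>(i, j)\<close> of the positions of its southwest and northeast
  endpoints; \<open>hook_points\<close> is the subset of the plane that it occupies.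
\<close>

type_synonym hook = "nat \<times> nat"

definition is_hook :: "nat \<Rightarrow> (nat \<Rightarrow> nat) \<Rightarrow> hook \<Rightarrow> bool" where
  "is_hook n p h \<longleftrightarrow> 1 \<le> fst h \<and> fst h < snd h \<and> snd h \<le> n \<and> p (fst h) < p (snd h)"

definition sw_endpoint :: "(nat \<Rightarrow> nat) \<Rightarrow> hook \<Rightarrow> real \<times> real" where
  "sw_endpoint p h = pt p (fst h)"

definition ne_endpoint :: "(nat \<Rightarrow> nat) \<Rightarrow> hook \<Rightarrow> real \<times> real" where
  "ne_endpoint p h = pt p (snd h)"

definition hook_points :: "(nat \<Rightarrow> nat) \<Rightarrow> hook \<Rightarrow> (real \<times> real) set" where
  "hook_points p h =
     {real (fst h)} \<times> {real (p (fst h))..real (p (snd h))} \<union>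
     {real (fst h)..real (snd h)} \<times> {real (p (snd h))}"

text \<open>
  Strictly above: the two endpoints of a hook are points of the plot on the hook itself and must
  not count as lying above it.
\<close>

definition directly_above :: "real \<times> real \<Rightarrow> (real \<times> real) set \<Rightarrow> bool" where
  "directly_above q X \<longleftrightarrow> (\<exists>y. (fst q, y) \<in> X \<and> y < snd q)"

definition valid_hook_configuration :: "nat \<Rightarrow> (nat \<Rightarrow> nat) \<Rightarrow> hook list \<Rightarrow> bool" where
  "valid_hook_configuration n p hs \<longleftrightarrow>
     (\<forall>h\<in>set hs. is_hook n p h) \<and>
     map (sw_endpoint p) hs = map (pt p) (sorted_list_of_set (descents n p)) \<and>
     (\<forall>h\<in>set hs. \<forall>q\<in>plot n p. \<not> directly_above q (hook_points p h)) \<and>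
     (\<forall>a<length hs. \<forall>b<length hs. a \<noteq> b \<longrightarrow>
        (\<forall>q\<in>hook_points p (hs ! a) \<inter> hook_points p (hs ! b).
           q = ne_endpoint p (hs ! a) \<and> q = sw_endpoint p (hs ! b) \<or>
           q = sw_endpoint p (hs ! a) \<and> q = ne_endpoint p (hs ! b)))"

text \<open>
  A configuration is paired with its permutation, so that configurations of distinct permutations
  are distinct.
\<close>

definition VHC :: "nat \<Rightarrow> (nat \<Rightarrow> nat) \<Rightarrow> ((nat \<Rightarrow> nat) \<times> hook list) set" where
  "VHC n p = {(p, hs) | hs. valid_hook_configuration n p hs}"

definition VHC_set :: "nat \<Rightarrow> (nat \<Rightarrow> nat) set \<Rightarrow> ((nat \<Rightarrow> nat) \<times> hook list) set" where
  "VHC_set n A = (\<Union>p\<in>A. VHC n p)"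

end

theory Submission imports Defs begin

text \<open>
  A permutation avoiding 132 and 321 that is not the identity has the one-line notation
  $(m-d+1)\cdots m\; 1\cdots (m-d)\; (m+1)\cdots n$ with \<open>1 \<le> d < m \<le> n\<close>. Its only descent is \<open>d\<close>,
  with descent top of height \<open>m\<close>, and the northeast endpoint of the single hook can be any of the
  points \<open>(j, j)\<close> with \<open>m < j \<le> n\<close>. Together with the identity this gives
  $1 + {n \choose 3}$ configurations, and $1-3x+3x^2 = (1-x)^3 + x^3$.
\<close>

text \<open>Everything outside \<open>{1..m}\<close> is fixed, so one and the same function serves
  every length \<open>n \<ge> m\<close>. This lets an induction on the length carry a classification
  over unchanged.\<close>

definition block_swap :: "nat \<Rightarrow> nat \<Rightarrow> nat \<Rightarrow> nat" where
  "block_swap d m i =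
     (if 1 \<le> i \<and> i \<le> d then i + (m - d) else if d < i \<and> i \<le> m then i - d else i)"

lemma block_swap_top: "1 \<le> d \<Longrightarrow> d \<le> m \<Longrightarrow> block_swap d m d = m"
  by (simp add: block_swap_def)

section \<open>Pattern avoidance\<close>

lemma contains_pattern_3:
  "contains_pattern n p [a, b, c] \<longleftrightarrow>
     (\<exists>i j k. 1 \<le> i \<and> i < j \<and> j < k \<and> k \<le> n \<and>
        (p i < p j \<longleftrightarrow> a < b) \<and> (p j < p i \<longleftrightarrow> b < a) \<and>
        (p i < p k \<longleftrightarrow> a < c) \<and> (p k < p i \<longleftrightarrow> c < a) \<and>
        (p j < p k \<longleftrightarrow> b < c) \<and> (p k < p j \<longleftrightarrow> c < b))"
proof
  have less_3: "{..<length [a, b, c]} = {0, 1, 2}" by auto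
  {
    assume "contains_pattern n p [a, b, c]"
    then obtain f where f: "strict_mono_on {0, 1, 2} f" "f ` {0, 1, 2} \<subseteq> {1..n}"
      and o: "\<forall>x<3. \<forall>y<3. p (f x) < p (f y) \<longleftrightarrow> [a, b, c] ! x < [a, b, c] ! y"
      unfolding contains_pattern_def less_3 by (auto simp: numeral_3_eq_3)
    have "f 0 < f 1" "f 1 < f 2" using f(1) by (auto simp: strict_mono_on_def)
    with f(2) o[rule_format, of 0 1] o[rule_format, of 1 0] o[rule_format, of 0 2]
      o[rule_format, of 2 0] o[rule_format, of 1 2] o[rule_format, of 2 1]
    show "\<exists>i j k. 1 \<le> i \<and> i < j \<and> j < k \<and> k \<le> n \<and>
        (p i < p j \<longleftrightarrow> a < b) \<and> (p j < p i \<longleftrightarrow> b < a) \<and>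
        (p i < p k \<longleftrightarrow> a < c) \<and> (p k < p i \<longleftrightarrow> c < a) \<and>
        (p j < p k \<longleftrightarrow> b < c) \<and> (p k < p j \<longleftrightarrow> c < b)"
      by (intro exI[of _ "f 0"] exI[of _ "f 1"] exI[of _ "f 2"]) simp
  next
    assume "\<exists>i j k. 1 \<le> i \<and> i < j \<and> j < k \<and> k \<le> n \<and>
        (p i < p j \<longleftrightarrow> a < b) \<and> (p j < p i \<longleftrightarrow> b < a) \<and>
        (p i < p k \<longleftrightarrow> a < c) \<and> (p k < p i \<longleftrightarrow> c < a) \<and>
        (p j < p k \<longleftrightarrow> b < c) \<and> (p k < p j \<longleftrightarrow> c < b)"
    then obtain i j k where "1 \<le> i" "i < j" "j < k" "k \<le> n"
      "p i < p j \<longleftrightarrow> a < b" "p j < p i \<longleftrightarrow> b < a" "p i < p k \<longleftrightarrow> a < c"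
      "p k < p i \<longleftrightarrow> c < a" "p j < p k \<longleftrightarrow> b < c" "p k < p j \<longleftrightarrow> c < b"
      by blast
    then show "contains_pattern n p [a, b, c]"
      unfolding contains_pattern_def less_3
      by (intro exI[of _ "\<lambda>x. [i, j, k] ! x"])
        (auto simp: strict_mono_on_def less_Suc_eq numeral_2_eq_2)
  }
qed

text \<open>Of the six comparisons that describe a pattern of length three, two consecutive strict
  inequalities between the values imply the rest.\<close>

lemma Av_132_321_iff:
  "p \<in> Av n {[1,3,2], [3,2,1]} \<longleftrightarrow>
     p permutes {1..n} \<and>
     (\<forall>i j k. 1 \<le> i \<longrightarrow> i < j \<longrightarrow> j < k \<longrightarrow> k \<le> n \<longrightarrow>
        \<not> (p i < p k \<and> p k < p j) \<and> \<not> (p k < p j \<and> p j < p i))"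
proof -
  have "contains_pattern n p [1,3,2] \<longleftrightarrow>
      (\<exists>i j k. 1 \<le> i \<and> i < j \<and> j < k \<and> k \<le> n \<and> p i < p k \<and> p k < p j)"
    unfolding contains_pattern_3 by (intro arg_cong[where f = Ex] ext) auto
  moreover have "contains_pattern n p [3,2,1] \<longleftrightarrow>
      (\<exists>i j k. 1 \<le> i \<and> i < j \<and> j < k \<and> k \<le> n \<and> p k < p j \<and> p j < p i)"
    unfolding contains_pattern_3 by (intro arg_cong[where f = Ex] ext) auto
  ultimately show ?thesis unfolding Av_def by blast
qed

section \<open>Classification of the permutations avoiding 132 and 321\<close>

lemma block_swap_permutes:
  assumes "d \<le> m" "m \<le> n"
  shows "block_swap d m permutes {1..n}"
proof (rule bij_imp_permutes)
  show "bij_betw (block_swap d m) {1..n} {1..n}"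
    \<comment> \<open>Exchanging blocks of lengths \<open>d\<close> and \<open>m - d\<close> is
      undone by exchanging blocks of lengths \<open>m - d\<close> and \<open>d\<close>.\<close>
    by (rule bij_betw_byWitness[where f' = "block_swap (m - d) m"])
      (use assms in \<open>auto simp: block_swap_def\<close>)
qed (use assms in \<open>auto simp: block_swap_def\<close>)

text \<open>Every inversion leads from the first block to the second. The middle entry of a 321
  would lie in both blocks; the 1 of a 132 would precede the 3 in the first block and hence exceed
  the 2.\<close>

lemma block_swap_in_Av:
  assumes "d \<le> m" "m \<le> n"
  shows "block_swap d m \<in> Av n {[1,3,2], [3,2,1]}"
  unfolding Av_132_321_iff using block_swap_permutes[OF assms] assms
  by (auto simp: block_swap_def split: if_splits)

lemma id_in_Av: "id \<in> Av n {[1,3,2], [3,2,1]}"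
  unfolding Av_132_321_iff by (auto simp: permutes_id)

text \<open>The counted set is mapped bijectively onto \<open>{1..p i}\<close>. In this way the
  values of \<open>p\<close> can be read off from their relative order alone.\<close>

lemma permutes_eq_card_le:
  assumes "p permutes {1..n}" "i \<in> {1..n}"
  shows "p i = card {j \<in> {1..n}. p j \<le> p i}"
proof -
  have "p ` {j \<in> {1..n}. p j \<le> p i} = {1..p i}"
  proof (intro equalityI subsetI)
    fix v assume v: "v \<in> {1..p i}"
    moreover have "p i \<le> n" using permutes_in_image[OF assms(1)] assms(2) by auto
    ultimately have "v \<in> p ` {1..n}" using permutes_image[OF assms(1)] by auto
    with v show "v \<in> p ` {j \<in> {1..n}. p j \<le> p i}" by auto
  next
    fix v assume "v \<in> p ` {j \<in> {1..n}. p j \<le> p i}"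
    then obtain j where "j \<in> {1..n}" "v = p j" "p j \<le> p i" by auto
    then show "v \<in> {1..p i}" using permutes_in_image[OF assms(1), of j] by auto
  qed
  then have "card {j \<in> {1..n}. p j \<le> p i} = card {1..p i}"
    using card_image[OF inj_on_subset[OF permutes_inj[OF assms(1)] subset_UNIV]] by metis
  then show ?thesis by simp
qed

text \<open>Avoidance forces the relative order of any two entries, and counting the smaller entries
  then gives the values.\<close>

lemma Av_maximum_not_last:
  assumes p: "p \<in> Av n {[1,3,2], [3,2,1]}" and k: "1 \<le> k" "k < n" "p k = n"
  shows "p = block_swap k n"
proof -
  have perm: "p permutes {1..n}"
    and no132: "\<And>i j l. 1 \<le> i \<Longrightarrow> i < j \<Longrightarrow> j < l \<Longrightarrow> l \<le> n \<Longrightarrow> \<not> (p i < p l \<and> p l < p j)"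
    and no321: "\<And>i j l. 1 \<le> i \<Longrightarrow> i < j \<Longrightarrow> j < l \<Longrightarrow> l \<le> n \<Longrightarrow> \<not> (p l < p j \<and> p j < p i)"
    using p unfolding Av_132_321_iff by blast+
  have inj: "p i = p j \<longleftrightarrow> i = j" for i j
    using permutes_inj[OF perm] by (auto dest: injD)
  have less_n: "p i < n" if "i \<in> {1..n}" "i \<noteq> k" for i
    using permutes_in_image[OF perm, of i] that inj[of i k] k by auto
  \<comment> \<open>Otherwise \<open>i\<close>, \<open>k\<close>, \<open>j\<close> form a 132 with
    the maximum as its 3.\<close>
  have left_right: "p j < p i" if "1 \<le> i" "i \<le> k" "k < j" "j \<le> n" for i j
    using no132[of i k j] less_n[of j] inj[of i j] that k by (cases "i = k") auto
  \<comment> \<open>Here the maximum would be the 3 of a 321.\<close>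
  have right: "p i < p j" if "k < i" "i < j" "j \<le> n" for i j
    using no321[of k i j] less_n[of i] inj[of i j] that k by auto
  \<comment> \<open>Here the last entry would be the 1 of a 321; as \<open>k < n\<close>, it belongs
    to the right block and lies below the whole left block.\<close>
  have left: "p i < p j" if "1 \<le> i" "i < j" "j \<le> k" for i j
    using no321[of i j n] left_right[of j n] inj[of i j] that k by auto
  have "p i = block_swap k n i" for i
  proof -
    consider "i \<notin> {1..n}" | "1 \<le> i" "i \<le> k" | "k < i" "i \<le> n" by fastforce
    then show ?thesis
    proof cases
      case 1
      then show ?thesis using permutes_not_in[OF perm, of i] k by (auto simp: block_swap_def)
    next
      case 2
      \<comment> \<open>The rank of \<open>p i\<close> is thus \<open>i + (n - k)\<close>.\<close>
      have "{j \<in> {1..n}. p j \<le> p i} = {1..i} \<union> {k<..n}"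
      proof (intro equalityI subsetI)
        fix j assume "j \<in> {j \<in> {1..n}. p j \<le> p i}"
        then show "j \<in> {1..i} \<union> {k<..n}" using left[of i j] 2 by force
      next
        fix j assume "j \<in> {1..i} \<union> {k<..n}"
        then consider "j = i" | "1 \<le> j" "j < i" | "k < j" "j \<le> n" by fastforce
        then show "j \<in> {j \<in> {1..n}. p j \<le> p i}"
          using left[of j i] left_right[of i j] 2 k by cases auto
      qed
      moreover have "{1..i} \<inter> {k<..n} = {}" using 2 by auto
      ultimately show ?thesis
        using permutes_eq_card_le[OF perm, of i] 2 k by (auto simp: card_Un_disjoint block_swap_def)
    next
      case 3
      have "{j \<in> {1..n}. p j \<le> p i} = {k<..i}"
      proof (intro equalityI subsetI)
        fix j assume "j \<in> {j \<in> {1..n}. p j \<le> p i}"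
        then show "j \<in> {k<..i}" using left_right[of j i] right[of i j] 3 by force
      next
        fix j assume "j \<in> {k<..i}"
        then show "j \<in> {j \<in> {1..n}. p j \<le> p i}" using right[of j i] 3 k by (cases "j = i") auto
      qed
      then show ?thesis
        using permutes_eq_card_le[OF perm, of i] 3 k by (auto simp: block_swap_def)
    qed
  qed
  then show ?thesis by blast
qed

text \<open>Induction on the length, by the position of the maximum: if it is last, the same
  function already belongs to the shorter length; otherwise \<open>m\<close> is the current
  length.\<close>

lemma Av_cases:
  assumes "p \<in> Av n {[1,3,2], [3,2,1]}"
  obtains "p = id" | d m where "1 \<le> d" "d < m" "m \<le> n" "p = block_swap d m"
proof -
  have "p = id \<or> (\<exists>d m. 1 \<le> d \<and> d < m \<and> m \<le> n \<and> p = block_swap d m)"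
    using assms
  proof (induction n)
    case 0
    then have "p permutes {1..0}" unfolding Av_132_321_iff by blast
    then show ?case by (simp add: id_def)
  next
    case (Suc n)
    have perm: "p permutes {1..Suc n}" using Suc.prems unfolding Av_132_321_iff by blast
    obtain k where k: "k \<in> {1..Suc n}" "p k = Suc n"
      using permutes_image[OF perm] by (metis atLeastAtMost_iff imageE le_refl le_add1 plus_1_eq_Suc)
    show ?case
    proof (cases "k = Suc n")
      case True
      have "p permutes {1..n}"
        using perm True k by (intro permutes_superset[OF perm]) (auto simp: le_Suc_eq)
      then have "p \<in> Av n {[1,3,2], [3,2,1]}"
        using Suc.prems unfolding Av_132_321_iff by (meson le_SucI)
      then show ?thesis using Suc.IH le_SucI by blast
    next
      case False
      then have "p = block_swap k (Suc n)"
        using Av_maximum_not_last[OF Suc.prems, of k] k by auto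
      then show ?thesis using False k by (intro disjI2 exI[of _ k] exI[of _ "Suc n"]) auto
    qed
  qed
  then show ?thesis using that by blast
qed

section \<open>Valid hook configurations\<close>

lemma descents_id: "descents n id = {}"
  by (auto simp: descents_def)

lemma descents_block_swap:
  assumes "1 \<le> d" "d < m" "m \<le> n"
  shows "descents n (block_swap d m) = {d}"
  using assms by (auto simp: descents_def block_swap_def split: if_splits)

lemma valid_hook_configuration_id:
  "valid_hook_configuration n id hs \<longleftrightarrow> hs = []"
  by (auto simp: valid_hook_configuration_def descents_id)

lemma valid_hook_configuration_block_swap:
  assumes "1 \<le> d" "d < m" "m \<le> n"
  shows "valid_hook_configuration n (block_swap d m) hs \<longleftrightarrow> (\<exists>j. m < j \<and> j \<le> n \<and> hs = [(d, j)])"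
proof
  let ?p = "block_swap d m"
  have pd: "?p d = m" using assms by (simp add: block_swap_top)
  {
    assume v: "valid_hook_configuration n ?p hs"
    then have "map (sw_endpoint ?p) hs = [pt ?p d]"
      by (simp add: valid_hook_configuration_def descents_block_swap[OF assms])
    then obtain h where h: "hs = [h]" "fst h = d"
      by (auto simp: sw_endpoint_def pt_def)
    moreover have "is_hook n ?p h" using v h by (simp add: valid_hook_configuration_def)
    then have "m < ?p (snd h)" "snd h \<le> n" using h pd by (auto simp: is_hook_def)
    \<comment> \<open>Positions up to \<open>m\<close> carry only values up to
      \<open>m\<close>.\<close>
    then have "m < snd h" using assms by (auto simp: block_swap_def split: if_splits)
    ultimately show "\<exists>j. m < j \<and> j \<le> n \<and> hs = [(d, j)]"
      using \<open>snd h \<le> n\<close> by (intro exI[of _ "snd h"]) (auto simp: prod_eq_iff)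
  next
    assume "\<exists>j. m < j \<and> j \<le> n \<and> hs = [(d, j)]"
    then obtain j where j: "m < j" "j \<le> n" "hs = [(d, j)]" by blast
    have pj: "?p j = j" using j assms by (auto simp: block_swap_def)
    have "\<not> directly_above q (hook_points ?p (d, j))" if q: "q \<in> plot n ?p" for q
    proof
      assume "directly_above q (hook_points ?p (d, j))"
      moreover obtain i where "q = (real i, real (?p i))"
        using q by (auto simp: plot_def pt_def)
      ultimately obtain y where y: "(real i, y) \<in> hook_points ?p (d, j)" "y < real (?p i)"
        by (auto simp: directly_above_def)
      have below: "?p i \<le> j" if "i \<le> j"
        using that assms j by (auto simp: block_swap_def)
      \<comment> \<open>On the vertical segment the only plot point in that column is its lower end,
        of height \<open>m\<close>; the horizontal segment has height \<open>j\<close>, which no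
        point up to position \<open>j\<close> exceeds.\<close>
      from y(1) have "i = d \<and> real m \<le> y \<or> i \<le> j \<and> y = real j"
        by (auto simp: hook_points_def pd pj)
      then show False using y(2) below pd by auto
    qed
    moreover have "is_hook n ?p (d, j)" using assms j by (simp add: is_hook_def pd pj)
    ultimately show "valid_hook_configuration n ?p hs"
      by (simp add: valid_hook_configuration_def j descents_block_swap[OF assms] sw_endpoint_def)
  }
qed

text \<open>The pair \<open>d\<close>, \<open>m\<close> determines the permutation and
  \<open>j\<close> the hook. The largest index comes first in the triple, so that each range depends
  only on earlier components.\<close>

lemma VHC_set_Av_132_321:
  "VHC_set n (Av n {[1,3,2], [3,2,1]}) =
     insert (id, [])
       ((\<lambda>(j, m, d). (block_swap d m, [(d, j)])) ` (SIGMA j:{1..n}. SIGMA m:{1..<j}. {1..<m}))"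
  (is "?V = insert _ (?f ` ?T)")
proof (intro equalityI subsetI)
  fix x assume "x \<in> ?V"
  then obtain p hs where x: "x = (p, hs)" "p \<in> Av n {[1,3,2], [3,2,1]}"
      "valid_hook_configuration n p hs"
    by (auto simp: VHC_set_def VHC_def)
  from x(2) show "x \<in> insert (id, []) (?f ` ?T)"
  proof (cases rule: Av_cases)
    case 1
    then show ?thesis using x by (simp add: valid_hook_configuration_id)
  next
    case (2 d m)
    then obtain j where "m < j" "j \<le> n" "hs = [(d, j)]"
      using x valid_hook_configuration_block_swap[of d m n hs] by auto
    then have "x = ?f (j, m, d)" "(j, m, d) \<in> ?T" using x 2 by auto
    then show ?thesis by blast
  qed
next
  fix x assume "x \<in> insert (id, []) (?f ` ?T)"
  then consider "x = (id, [])"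
    | j m d where "1 \<le> d" "d < m" "m < j" "j \<le> n" "x = (block_swap d m, [(d, j)])"
    by auto
  then show "x \<in> ?V"
  proof cases
    case 1
    then show ?thesis
      using id_in_Av[of n] by (auto simp: VHC_set_def VHC_def valid_hook_configuration_id)
  next
    case 2
    then show ?thesis
      using block_swap_in_Av[of d m n] valid_hook_configuration_block_swap[of d m n]
      by (auto simp: VHC_set_def VHC_def)
  qed
qed

section \<open>Counting\<close>

text \<open>The hockey-stick identity, applied twice: a fixed \<open>j\<close> leaves
  \<open>(j - 1) choose 2\<close> pairs, and these numbers add up to
  \<open>n choose 3\<close>.\<close>

lemma card_increasing_triples:
  "card (SIGMA j:{1..n}. SIGMA m:{1..<j}. {1..<m}) = n choose 3"
proof -
  have pairs: "(\<Sum>m = 1..<j. m - 1) = (j - 1) choose 2" for j :: nat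
  proof (induction j)
    case (Suc j)
    then show ?case by (cases j) (auto simp: numeral_2_eq_2)
  qed simp
  have "(\<Sum>j = 1..n. (j - 1) choose 2) = n choose 3"
    by (induction n) (auto simp: numeral_3_eq_3 numeral_2_eq_2)
  then show ?thesis by (simp add: pairs[simplified])
qed

lemma card_VHC_set_Av_132_321:
  "card (VHC_set n (Av n {[1,3,2], [3,2,1]})) = 1 + (n choose 3)"
proof -
  let ?f = "\<lambda>(j, m, d). (block_swap d m, [(d, j)])"
  let ?T = "SIGMA j:{1..n}. SIGMA m:{1..<j}. {1..<m}"
  have "inj_on ?f ?T"
  proof (rule inj_onI)
    fix x y assume "x \<in> ?T" "y \<in> ?T" "?f x = ?f y"
    \<comment> \<open>The hook reveals \<open>d\<close> and \<open>j\<close>; evaluating the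
      permutation at \<open>d\<close> will recover \<open>m\<close>.\<close>
    then obtain j m d m' where "x = (j, m, d)" "y = (j, m', d)"
        "1 \<le> d" "d < m" "d < m'" "block_swap d m = block_swap d m'"
      by auto
    then show "x = y" by (metis block_swap_top less_imp_le)
  qed
  then have "card (?f ` ?T) = n choose 3"
    by (simp only: card_image card_increasing_triples)
  moreover have "(id, []) \<notin> ?f ` ?T" by auto
  moreover have "finite (?f ` ?T)" by (intro finite_imageI finite_SigmaI) auto
  ultimately show ?thesis unfolding VHC_set_Av_132_321 by simp
qed

section \<open>Generating function\<close>

text \<open>Multiplication by \<open>1 - fps_X\<close> is the backward difference of the
  coefficients.\<close>

lemma one_minus_X_mult_Abs_fps:
  fixes a :: "nat \<Rightarrow> 'a::comm_ring_1"
  shows "(1 - fps_X) * Abs_fps a = Abs_fps (\<lambda>n. case n of 0 \<Rightarrow> a 0 | Suc k \<Rightarrow> a (Suc k) - a k)"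
  by (rule fps_ext) (auto simp: left_diff_distrib split: nat.split)

text \<open>This is the series \<open>x^k / (1 - x)^(k+1)\<close> of a column of Pascal's triangle,
  written as a product so that it makes sense over any commutative ring.\<close>

lemma fps_binomial_column:
  "(1 - fps_X) ^ Suc k * Abs_fps (\<lambda>n. of_nat (n choose k)) = (fps_X ^ k :: 'a::comm_ring_1 fps)"
proof (induction k)
  case 0
  show ?case
    by (auto simp: one_minus_X_mult_Abs_fps fps_eq_iff split: nat.split)
next
  case (Suc k)
  \<comment> \<open>Pascal's rule: the difference of one column is the preceding column shifted by
    one.\<close>
  have "(1 - fps_X) * Abs_fps (\<lambda>n. of_nat (n choose Suc k) :: 'a) =
      fps_X * Abs_fps (\<lambda>n. of_nat (n choose k))"
    unfolding one_minus_X_mult_Abs_fps by (rule fps_ext) (auto split: nat.split)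
  then have "(1 - fps_X) ^ Suc (Suc k) * Abs_fps (\<lambda>n. of_nat (n choose Suc k) :: 'a) =
      fps_X * ((1 - fps_X) ^ Suc k * Abs_fps (\<lambda>n. of_nat (n choose k)))"
    by (simp add: power_Suc2[of _ "Suc k"] mult.assoc mult.left_commute del: power_Suc)
  then show ?case using Suc.IH by simp
qed

theorem theorem4:
  "Abs_fps (\<lambda>n. of_nat (card (VHC_set n (Av n {[1,3,2], [3,2,1]})))) =
     (1 - 3 * fps_X + 3 * fps_X ^ 2) / ((1 - fps_X) ^ 4 :: rat fps)"
proof -
  let ?A = "\<lambda>k. Abs_fps (\<lambda>n. of_nat (n choose k)) :: rat fps"
  let ?F = "Abs_fps (\<lambda>n. of_nat (card (VHC_set n (Av n {[1,3,2], [3,2,1]})))) :: rat fps"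
  \<comment> \<open>The identity contributes 1, which is \<open>n choose 0\<close>, so both summands
    are binomial columns.\<close>
  have F: "?F = ?A 0 + ?A 3"
    unfolding card_VHC_set_Av_132_321 by (rule fps_ext) simp
  \<comment> \<open>Column 0 absorbs one factor and column 3 all four.\<close>
  have "(1 - fps_X) ^ 4 * ?F = (1 - fps_X) ^ 3 * ((1 - fps_X) ^ Suc 0 * ?A 0) + (1 - fps_X) ^ Suc 3 * ?A 3"
    unfolding F by (simp add: algebra_simps eval_nat_numeral)
  also have "\<dots> = (1 - fps_X) ^ 3 + fps_X ^ 3"
    unfolding fps_binomial_column by simp
  also have "\<dots> = 1 - 3 * fps_X + 3 * fps_X ^ 2"
    by (simp add: algebra_simps eval_nat_numeral)
  finally have eq: "?F * (1 - fps_X) ^ 4 = 1 - 3 * fps_X + 3 * fps_X ^ 2"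
    by (simp add: mult.commute)
  \<comment> \<open>The constant coefficient is 1, so the denominator is nonzero and can be
    cancelled.\<close>
  have "fps_nth ((1 - fps_X) ^ 4 :: rat fps) 0 \<noteq> 0" by (simp add: fps_power_zeroth)
  then have "(1 - fps_X :: rat fps) ^ 4 \<noteq> 0" by (metis fps_zero_nth)
  then show ?thesis unfolding eq[symmetric] by simp
qed

end
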